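(* Let $\Lambda$ be a nonempty set and let $E$ be a linear subspace of $\mathbb{R}^\Lambda$ endowed with an absolute norm. Suppose there is a dense subset $A\subseteq S_E$ such that for every $(a_\lambda)\in A$ there exists $(b_\lambda)\in S_{E'}$ satisfying $\sum_{\lambda\in\Lambda} b_\lambda a_\lambda=1$. Then, for every family $\{X_\lambda : \lambda\in\Lambda\}$ of nonzero Banach spaces, $$n\Bigl(\Bigl[\bigoplus_{\lambda\in\Lambda}X_\lambda\Bigr]_E\Bigr)\leq \inf\{n(X_\lambda):\lambda\in\Lambda\}.$$
   Context: For a Banach space $X$ (real or complex), $B_X$, $S_X$, $X^*$ denote its closed unit ball, unit sphere and dual, and $L(X)$ the bounded linear operators on $X$. Put $\Pi(X)=\{(x,x^* )\in S_X\times S_{X^*}: x^*(x)=1\}$. The numerical radius of $T\in L(X)$ is $v(T)=\sup\{|x^*(Tx)|:(x,x^* )\in\Pi(X)\}$, and the numerical index of $X$ is $n(X)=\inf\{v(T): T\in L(X),\ \|T\|=1\}$. An absolute norm on a linear subspace $E$ of $\mathbb{R}^\Lambda$ is a complete norm $\|\cdot\|_E$ such that: (a) if $(a_\lambda),(b_\lambda)\in\mathbb{R}^\Lambda$ satisfy $|a_\lambda|=|b_\lambda|$ for all $\lambda$ and $(a_\lambda)\in E$, then $(b_\lambda)\in E$ and $\|(a_\lambda)\|_E=\|(b_\lambda)\|_E$; (b) for every $\lambda\in\Lambda$, the characteristic function $\chi_{\{\lambda\}}$ belongs to $E$ and has norm $1$. The Köthe dual of $E$ is $E'=\{(b_\lambda)\in\mathbb{R}^\Lambda: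 \|(b_\lambda)\|_{E'}:=\sup_{(a_\lambda)\in B_E}\sum_{\lambda}|b_\lambda||a_\lambda|<\infty\}$. For a family $\{X_\lambda:\lambda\in\Lambda\}$ of Banach spaces over the same scalar field ($\mathbb{R}$ or $\mathbb{C}$), the $E$-sum is $\bigl[\bigoplus_{\lambda}X_\lambda\bigr]_E=\{(x_\lambda): x_\lambda\in X_\lambda\ \forall\lambda,\ (\|x_\lambda\|)\in E\}$ with norm $\|(x_\lambda)\|=\|(\|x_\lambda\|)\|_E$. *)

theory Defs
  imports "HOL-Analysis.Analysis" "HOL-Algebra.Module"
begin

text \<open>
  The members of a family of Banach spaces have different underlying sets, operations and norms, so a
  Banach space is a record with an explicit carrier. It extends the module record of HOL-Algebra by
  a norm; the ring fields \<open>mult\<close> and \<open>one\<close> inherited from that record play no role.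
\<close>

record ('k, 'v) normed_space = "('k, 'v) module" +
  vnorm :: "'v \<Rightarrow> real"

text \<open>
  The scalar field is a type of class \<open>real_normed_field\<close>, whose norm is multiplicative. By the
  theorem of Ostrowski and Mazur, the fields in this class are, up to isometric isomorphism, exactly
  the real and the complex numbers. The record below serves as the ring of scalars and as the
  one-dimensional space over it.
\<close>

definition scalars :: "('k::real_normed_field, 'k) normed_space" where
  "scalars = \<lparr>carrier = UNIV, mult = (*), one = 1, zero = 0, add = (+), smult = (*), vnorm = norm\<rparr>"

definition vdist :: "('k, 'v) normed_space \<Rightarrow> 'v \<Rightarrow> 'v \<Rightarrow> real" where
  "vdist X x y = vnorm X (x \<ominus>\<^bsub>X\<^esub> y)"

definition normed_vector_space :: "('k::real_normed_field, 'v) normed_space \<Rightarrow> bool" where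
  "normed_vector_space X \<longleftrightarrow>
     Module.module (scalars :: ('k, 'k) normed_space) X \<and>
     (\<forall>x\<in>carrier X. vnorm X x = 0 \<longleftrightarrow> x = \<zero>\<^bsub>X\<^esub>) \<and>
     (\<forall>c. \<forall>x\<in>carrier X. vnorm X (c \<odot>\<^bsub>X\<^esub> x) = norm c * vnorm X x) \<and>
     (\<forall>x\<in>carrier X. \<forall>y\<in>carrier X. vnorm X (x \<oplus>\<^bsub>X\<^esub> y) \<le> vnorm X x + vnorm X y)"

definition banach_space :: "('k::real_normed_field, 'v) normed_space \<Rightarrow> bool" where
  "banach_space X \<longleftrightarrow>
     normed_vector_space X \<and> Metric_space.mcomplete (carrier X) (vdist X)"

definition unit_ball :: "('k, 'v) normed_space \<Rightarrow> 'v set" where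
  "unit_ball X = {x \<in> carrier X. vnorm X x \<le> 1}"

definition unit_sphere :: "('k, 'v) normed_space \<Rightarrow> 'v set" where
  "unit_sphere X = {x \<in> carrier X. vnorm X x = 1}"

text \<open>
  Operators are total functions on the underlying type; only their values on the carrier matter.
\<close>

definition bounded_operators ::
    "('k::real_normed_field, 'v) normed_space \<Rightarrow> ('k, 'w) normed_space \<Rightarrow> ('v \<Rightarrow> 'w) set" where
  "bounded_operators X Y =
     {T. T \<in> carrier X \<rightarrow> carrier Y \<and>
         (\<forall>x\<in>carrier X. \<forall>y\<in>carrier X. T (x \<oplus>\<^bsub>X\<^esub> y) = T x \<oplus>\<^bsub>Y\<^esub> T y) \<and>
         (\<forall>c. \<forall>x\<in>carrier X. T (c \<odot>\<^bsub>X\<^esub> x) = c \<odot>\<^bsub>Y\<^esub> T x) \<and>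
         (\<exists>C. \<forall>x\<in>carrier X. vnorm Y (T x) \<le> C * vnorm X x)}"

definition op_norm ::
    "('k::real_normed_field, 'v) normed_space \<Rightarrow> ('k, 'w) normed_space \<Rightarrow> ('v \<Rightarrow> 'w) \<Rightarrow> real" where
  "op_norm X Y T = (SUP x\<in>unit_ball X. vnorm Y (T x))"

definition dual_sphere :: "('k::real_normed_field, 'v) normed_space \<Rightarrow> ('v \<Rightarrow> 'k) set" where
  "dual_sphere X = {f \<in> bounded_operators X scalars. op_norm X scalars f = 1}"

definition Pi_pairs :: "('k::real_normed_field, 'v) normed_space \<Rightarrow> ('v \<times> ('v \<Rightarrow> 'k)) set" where
  "Pi_pairs X = {(x, f). x \<in> unit_sphere X \<and> f \<in> dual_sphere X \<and> f x = 1}"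

text \<open>
  The numerical radius and index are taken in \<open>[0, \<infinity>]\<close>, a complete lattice, so that every supremum
  and infimum below is a genuine one; for nonzero spaces both are finite.
\<close>

definition numerical_radius :: "('k::real_normed_field, 'v) normed_space \<Rightarrow> ('v \<Rightarrow> 'v) \<Rightarrow> ennreal" where
  "numerical_radius X T = (SUP (x, f)\<in>Pi_pairs X. ennreal (norm (f (T x))))"

definition numerical_index :: "('k::real_normed_field, 'v) normed_space \<Rightarrow> ennreal" where
  "numerical_index X =
     (INF T\<in>{T \<in> bounded_operators X X. op_norm X X T = 1}. numerical_radius X T)"

text \<open>
  The index set \<open>\<Lambda>\<close> is the type \<open>'i\<close>, which is nonempty. A set \<open>E\<close> of functions \<open>'i \<Rightarrow> real\<close> and a norm
  \<open>N\<close> on it form a space with pointwise operations; if this space is a module, then \<open>E\<close> is a linear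
  subspace.
\<close>

definition seq_space :: "('i \<Rightarrow> real) set \<Rightarrow> (('i \<Rightarrow> real) \<Rightarrow> real) \<Rightarrow> (real, 'i \<Rightarrow> real) normed_space" where
  "seq_space E N =
     \<lparr>carrier = E, mult = undefined, one = undefined, zero = (\<lambda>_. 0), add = (\<lambda>a b i. a i + b i),
      smult = (\<lambda>c a i. c * a i), vnorm = N\<rparr>"

definition absolute_norm :: "('i \<Rightarrow> real) set \<Rightarrow> (('i \<Rightarrow> real) \<Rightarrow> real) \<Rightarrow> bool" where
  "absolute_norm E N \<longleftrightarrow>
     banach_space (seq_space E N) \<and>
     (\<forall>a b. (\<forall>i. \<bar>a i\<bar> = \<bar>b i\<bar>) \<and> a \<in> E \<longrightarrow> b \<in> E \<and> N a = N b) \<and>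
     (\<forall>i. indicator {i} \<in> E \<and> N (indicator {i}) = 1)"

definition kothe_norm :: "('i \<Rightarrow> real) set \<Rightarrow> (('i \<Rightarrow> real) \<Rightarrow> real) \<Rightarrow> ('i \<Rightarrow> real) \<Rightarrow> ennreal" where
  "kothe_norm E N b = (SUP a\<in>unit_ball (seq_space E N). \<Sum>\<^sub>\<infinity>i. ennreal (\<bar>b i\<bar> * \<bar>a i\<bar>))"

definition kothe_dual :: "('i \<Rightarrow> real) set \<Rightarrow> (('i \<Rightarrow> real) \<Rightarrow> real) \<Rightarrow> ('i \<Rightarrow> real) set" where
  "kothe_dual E N = {b. kothe_norm E N b < \<infinity>}"

definition kothe_dual_sphere :: "('i \<Rightarrow> real) set \<Rightarrow> (('i \<Rightarrow> real) \<Rightarrow> real) \<Rightarrow> ('i \<Rightarrow> real) set" where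
  "kothe_dual_sphere E N = {b \<in> kothe_dual E N. kothe_norm E N b = 1}"

definition E_sum ::
    "('i \<Rightarrow> real) set \<Rightarrow> (('i \<Rightarrow> real) \<Rightarrow> real) \<Rightarrow> ('i \<Rightarrow> ('k, 'v) normed_space)
      \<Rightarrow> ('k, 'i \<Rightarrow> 'v) normed_space" where
  "E_sum E N X =
     \<lparr>carrier = {x. (\<forall>i. x i \<in> carrier (X i)) \<and> (\<lambda>i. vnorm (X i) (x i)) \<in> E},
      mult = undefined, one = undefined,
      zero = (\<lambda>i. \<zero>\<^bsub>X i\<^esub>), add = (\<lambda>x y i. x i \<oplus>\<^bsub>X i\<^esub> y i), smult = (\<lambda>c x i. c \<odot>\<^bsub>X i\<^esub> x i),
      vnorm = (\<lambda>x. N (\<lambda>i. vnorm (X i) (x i)))\<rparr>"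

end

theory Submission
  imports Defs
begin

text \<open>
  Let \<open>S\<close> be a norm-one operator on a summand \<open>X k\<close>, and let \<open>T\<close> act as \<open>S\<close> on the coordinate \<open>k\<close> and
  vanish on the others. Both operators have the same norm, so it suffices to see \<open>v(T) \<le> v(S)\<close>.

  Take \<open>(x, f)\<close> with \<open>f x = \<parallel>x\<parallel> = \<parallel>f\<parallel> = 1\<close> and let \<open>g\<close> be the restriction of \<open>f\<close> to the summand \<open>X k\<close>.
  An absolute norm does not grow when one coordinate shrinks, so replacing \<open>x k\<close> by a vector \<open>u\<close> with
  \<open>\<parallel>u\<parallel> \<le> \<parallel>x k\<parallel>\<close> keeps \<open>x\<close> in the unit ball, where \<open>|f| \<le> 1\<close>. As \<open>f x = 1\<close> is already extremal,
  \<open>|g u| \<le> |g (x k)|\<close>: the functional \<open>g\<close> attains its norm in the direction of \<open>x k\<close>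
  (lemma \<open>coordinate_functional_maximal\<close>). After normalisation \<open>x k\<close> and \<open>g\<close> form a pair in
  \<open>\<Pi>(X k)\<close>, and since \<open>|g (x k)| \<le> \<parallel>x k\<parallel> \<le> 1\<close>, undoing the normalisation gives
  \<open>|f (T x)| = |g (S (x k))| \<le> |g (x k)| v(S) \<le> v(S)\<close>
  (lemma \<open>norm_functional_coordinate_operator_le\<close>). The pair in \<open>\<Pi>(X k)\<close> is thus read off from \<open>f\<close>,
  with no extension of functionals and no description of the dual of the sum.
\<close>

section \<open>Normed spaces and bounded operators\<close>

lemma scalars_simps [simp]:
  "carrier scalars = UNIV" "zero scalars = 0" "one scalars = 1"
  "add scalars x y = x + y" "mult scalars x y = x * y" "smult scalars x y = x * y"
  "vnorm scalars x = norm x"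
  by (simp_all add: scalars_def)

locale normed_module =
  fixes V :: "('k::real_normed_field, 'v) normed_space" (structure)
  assumes normed: "normed_vector_space V"
begin

sublocale module "scalars :: ('k, 'k) normed_space" V
  using normed by (simp add: normed_vector_space_def)

lemma smult_mem [simp]: "x \<in> carrier V \<Longrightarrow> c \<odot> x \<in> carrier V"
  using smult_closed[of c x] by simp

lemma smult_0 [simp]: "c \<odot> \<zero> = \<zero>"
  using smult_r_null[of c] by simp

lemma vnorm_eq_0 [simp]: "x \<in> carrier V \<Longrightarrow> vnorm V x = 0 \<longleftrightarrow> x = \<zero>"
  and vnorm_smult [simp]: "x \<in> carrier V \<Longrightarrow> vnorm V (c \<odot> x) = norm c * vnorm V x"
  and vnorm_triangle: "x \<in> carrier V \<Longrightarrow> y \<in> carrier V \<Longrightarrow> vnorm V (x \<oplus> y) \<le> vnorm V x + vnorm V y"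
  using normed by (simp_all add: normed_vector_space_def)

lemma vnorm_zero [simp]: "vnorm V \<zero> = 0"
  by simp

lemma vnorm_nonneg [simp]:
  assumes "x \<in> carrier V" shows "0 \<le> vnorm V x"
proof -
  have "1 \<odot> x \<oplus> (-1) \<odot> x = \<zero>"
    using smult_l_distr[of 1 "-1" x] smult_l_null[of x] assms by simp
  then show ?thesis
    using vnorm_triangle[of "1 \<odot> x" "(-1) \<odot> x"] assms by simp
qed

end

lemma bounded_operators_bound:
  "T \<in> bounded_operators X Y \<Longrightarrow> \<exists>C. \<forall>x\<in>carrier X. vnorm Y (T x) \<le> C * vnorm X x"
  by (simp add: bounded_operators_def)

lemma bounded_operators_le_op_norm:
  assumes "T \<in> bounded_operators X Y" "x \<in> unit_ball X"
    and nonneg: "\<And>x. x \<in> carrier X \<Longrightarrow> 0 \<le> vnorm X x"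
  shows "vnorm Y (T x) \<le> op_norm X Y T"
  unfolding op_norm_def
proof (rule cSUP_upper[OF assms(2)])
  obtain C where C: "\<And>x. x \<in> carrier X \<Longrightarrow> vnorm Y (T x) \<le> C * vnorm X x"
    using bounded_operators_bound[OF assms(1)] by blast
  have "vnorm Y (T x) \<le> \<bar>C\<bar>" if "x \<in> unit_ball X" for x
  proof -
    have x: "x \<in> carrier X" "vnorm X x \<le> 1"
      using that by (auto simp: unit_ball_def)
    have "vnorm Y (T x) \<le> \<bar>C\<bar> * vnorm X x"
      using C[OF x(1)] mult_right_mono[OF abs_ge_self nonneg[OF x(1)], of C] by linarith
    also have "\<dots> \<le> \<bar>C\<bar>"
      using mult_left_mono[OF x(2), of "\<bar>C\<bar>"] by simp
    finally show ?thesis .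
  qed
  then show "bdd_above ((\<lambda>x. vnorm Y (T x)) ` unit_ball X)"
    by (auto simp: bdd_above_def)
qed

section \<open>Absolute norms and single coordinates\<close>

locale absolute_norm_space =
  fixes E :: "('i \<Rightarrow> real) set" and N :: "('i \<Rightarrow> real) \<Rightarrow> real"
  assumes absolute: "absolute_norm E N"
begin

sublocale E: normed_module "seq_space E N"
  using absolute by unfold_locales (simp add: absolute_norm_def banach_space_def)

lemma add_mem: "a \<in> E \<Longrightarrow> b \<in> E \<Longrightarrow> (\<lambda>i. a i + b i) \<in> E"
  using E.a_closed[of a b] by (simp add: seq_space_def)

lemma scale_mem: "a \<in> E \<Longrightarrow> (\<lambda>i. c * a i) \<in> E"
  using E.smult_mem[of a c] by (simp add: seq_space_def)

lemma N_scale: "a \<in> E \<Longrightarrow> N (\<lambda>i. c * a i) = \<bar>c\<bar> * N a"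
  using E.vnorm_smult[of a c] by (simp add: seq_space_def)

lemma N_triangle: "a \<in> E \<Longrightarrow> b \<in> E \<Longrightarrow> N (\<lambda>i. a i + b i) \<le> N a + N b"
  using E.vnorm_triangle[of a b] by (simp add: seq_space_def)

lemma N_nonneg: "a \<in> E \<Longrightarrow> 0 \<le> N a"
  using E.vnorm_nonneg[of a] by (simp add: seq_space_def)

lemma abs_cong: "a \<in> E \<Longrightarrow> (\<And>i. \<bar>a i\<bar> = \<bar>b i\<bar>) \<Longrightarrow> b \<in> E \<and> N b = N a"
  using absolute unfolding absolute_norm_def by metis

lemma singleton_mem: "(\<lambda>i. if i = k then t else 0) \<in> E"
  and N_singleton: "N (\<lambda>i. if i = k then t else 0) = \<bar>t\<bar>"
proof -
  have ind: "indicator {k} \<in> E" "N (indicator {k}) = 1"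
    using absolute by (auto simp: absolute_norm_def)
  have "(\<lambda>i. if i = k then t else 0) = (\<lambda>i. t * indicator {k} i)"
    by (auto simp: indicator_def)
  then show "(\<lambda>i. if i = k then t else 0) \<in> E" "N (\<lambda>i. if i = k then t else 0) = \<bar>t\<bar>"
    using scale_mem[OF ind(1), of t] N_scale[OF ind(1), of t] ind(2) by simp_all
qed

lemma update_mem:
  assumes "a \<in> E" shows "a(k := t) \<in> E"
proof -
  have "a(k := t) = (\<lambda>i. a i + (if i = k then t - a k else 0))"
    by auto
  then show ?thesis
    using add_mem[OF assms singleton_mem] by simp
qed

text \<open>
  Shrinking one coordinate of \<open>a\<close> (\<open>N_update_le\<close>) and erasing all the others (\<open>coordinate_le_N\<close>) both
  produce a convex combination of \<open>a\<close> and a copy of \<open>a\<close> with some signs flipped; the copy has the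
  norm of \<open>a\<close>.
\<close>

lemma N_convex_le:
  assumes "a \<in> E" "\<And>i. \<bar>a i\<bar> = \<bar>b i\<bar>" "0 \<le> s" "s \<le> 1"
  shows "N (\<lambda>i. s * a i + (1 - s) * b i) \<le> N a"
proof -
  have b: "b \<in> E" "N b = N a"
    using abs_cong[OF assms(1,2)] by auto
  have "N (\<lambda>i. s * a i + (1 - s) * b i) \<le> s * N a + (1 - s) * N b"
    using N_triangle[OF scale_mem[OF assms(1), of s] scale_mem[OF b(1), of "1 - s"]] assms(3,4)
    by (simp add: N_scale[OF assms(1)] N_scale[OF b(1)])
  then show ?thesis
    by (simp add: b(2) algebra_simps)
qed

lemma N_update_le:
  assumes "a \<in> E" "\<bar>t\<bar> \<le> \<bar>a k\<bar>" shows "N (a(k := t)) \<le> N a"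
proof (cases "a k = 0")
  case True
  then show ?thesis using assms(2) by (simp add: fun_upd_idem)
next
  case False
  \<comment> \<open>The weight for which \<open>t\<close> is the convex combination of \<open>a k\<close> and \<open>- a k\<close>.\<close>
  define s where "s = (1 + t / a k) / 2"
  have "\<bar>t / a k\<bar> \<le> 1"
    using assms(2) False by simp
  then have s: "0 \<le> s" "s \<le> 1"
    unfolding s_def abs_le_iff by simp_all
  have "s * a k + (1 - s) * - a k = t"
    using False by (simp add: s_def field_simps)
  then have "a(k := t) = (\<lambda>i. s * a i + (1 - s) * (a(k := - a k)) i)"
    by (auto simp: algebra_simps)
  then show ?thesis
    using N_convex_le[OF assms(1) _ s, of "a(k := - a k)"] by simp
qed

lemma coordinate_le_N:
  assumes "a \<in> E" shows "\<bar>a k\<bar> \<le> N a"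
proof -
  let ?b = "\<lambda>i. if i = k then a i else - a i"
  have "(\<lambda>i. 1/2 * a i + (1 - 1/2) * ?b i) = (\<lambda>i. if i = k then a k else 0)"
    by auto
  moreover have "N (\<lambda>i. 1/2 * a i + (1 - 1/2) * ?b i) \<le> N a"
    by (rule N_convex_le[OF assms]) auto
  ultimately show ?thesis
    by (simp only: N_singleton)
qed

end

section \<open>Operators on one summand of an absolute sum\<close>

locale absolute_sum = absolute_norm_space E N
  for E :: "('i \<Rightarrow> real) set" and N :: "('i \<Rightarrow> real) \<Rightarrow> real" +
  fixes X :: "'i \<Rightarrow> ('k::real_normed_field, 'v) normed_space"
  assumes summand_normed: "\<And>i. normed_vector_space (X i)"
begin

sublocale summand: normed_module "X i" for i
  using summand_normed by unfold_locales

abbreviation Z :: "('k, 'i \<Rightarrow> 'v) normed_space" where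
  "Z \<equiv> E_sum E N X"

lemma Z_mem_iff: "x \<in> carrier Z \<longleftrightarrow> (\<forall>i. x i \<in> carrier (X i)) \<and> (\<lambda>i. vnorm (X i) (x i)) \<in> E"
  and Z_add: "x \<oplus>\<^bsub>Z\<^esub> y = (\<lambda>i. x i \<oplus>\<^bsub>X i\<^esub> y i)"
  and Z_smult: "c \<odot>\<^bsub>Z\<^esub> x = (\<lambda>i. c \<odot>\<^bsub>X i\<^esub> x i)"
  and Z_vnorm: "vnorm Z x = N (\<lambda>i. vnorm (X i) (x i))"
  by (simp_all add: E_sum_def)

lemma Z_component [simp]: "x \<in> carrier Z \<Longrightarrow> x i \<in> carrier (X i)"
  by (simp add: Z_mem_iff)

lemma Z_vnorm_nonneg: "x \<in> carrier Z \<Longrightarrow> 0 \<le> vnorm Z x"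
  by (simp add: Z_mem_iff Z_vnorm N_nonneg)

lemma vnorm_component_le:
  assumes "x \<in> carrier Z" shows "vnorm (X k) (x k) \<le> vnorm Z x"
  using coordinate_le_N[of "\<lambda>i. vnorm (X i) (x i)" k] assms by (simp add: Z_mem_iff Z_vnorm)

definition embed :: "'i \<Rightarrow> 'v \<Rightarrow> 'i \<Rightarrow> 'v" where
  "embed k u = (\<lambda>i. if i = k then u else \<zero>\<^bsub>X i\<^esub>)"

lemma vnorm_embed_family:
  "(\<lambda>i. vnorm (X i) (embed k u i)) = (\<lambda>i. if i = k then vnorm (X k) u else 0)"
  by (auto simp: embed_def)

lemma embed_mem [simp]: "u \<in> carrier (X k) \<Longrightarrow> embed k u \<in> carrier Z"
  unfolding Z_mem_iff vnorm_embed_family by (simp add: singleton_mem) (simp add: embed_def)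

lemma vnorm_embed [simp]: "u \<in> carrier (X k) \<Longrightarrow> vnorm Z (embed k u) = vnorm (X k) u"
  unfolding Z_vnorm vnorm_embed_family by (simp add: N_singleton)

lemma embed_add:
  "u \<in> carrier (X k) \<Longrightarrow> v \<in> carrier (X k) \<Longrightarrow> embed k (u \<oplus>\<^bsub>X k\<^esub> v) = embed k u \<oplus>\<^bsub>Z\<^esub> embed k v"
  by (auto simp: embed_def Z_add)

lemma embed_smult: "u \<in> carrier (X k) \<Longrightarrow> embed k (c \<odot>\<^bsub>X k\<^esub> u) = c \<odot>\<^bsub>Z\<^esub> embed k u"
  by (auto simp: embed_def Z_smult)

lemma update_decomposition:
  "x \<in> carrier Z \<Longrightarrow> u \<in> carrier (X k) \<Longrightarrow> x(k := u) = x(k := \<zero>\<^bsub>X k\<^esub>) \<oplus>\<^bsub>Z\<^esub> embed k u"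
  by (auto simp: embed_def Z_add)

lemma update_in_sum:
  assumes "x \<in> carrier Z" "u \<in> carrier (X k)"
  shows "x(k := u) \<in> carrier Z"
    and "vnorm (X k) u \<le> vnorm (X k) (x k) \<Longrightarrow> vnorm Z (x(k := u)) \<le> vnorm Z x"
proof -
  have eq: "(\<lambda>i. vnorm (X i) ((x(k := u)) i)) = (\<lambda>i. vnorm (X i) (x i))(k := vnorm (X k) u)"
    by auto
  have a: "(\<lambda>i. vnorm (X i) (x i)) \<in> E"
    using assms(1) by (simp add: Z_mem_iff)
  show "x(k := u) \<in> carrier Z"
    unfolding Z_mem_iff eq using assms update_mem[OF a] by simp
  show "vnorm Z (x(k := u)) \<le> vnorm Z x"
    if "vnorm (X k) u \<le> vnorm (X k) (x k)"
    unfolding Z_vnorm eq by (rule N_update_le[OF a]) (use that assms in simp)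
qed

text \<open>
  With \<open>m = f (x(k := 0))\<close> and \<open>g = f \<circ> embed k\<close>, one has \<open>m + g (x k) = f x = 1\<close>, and
  \<open>|m + g u| = |f (x(k := u))| \<le> 1\<close> because \<open>x(k := u)\<close> stays in the unit ball. Multiplying \<open>u\<close> by a
  scalar of modulus one turns \<open>g u\<close> into the nonnegative real \<open>|g u|\<close>, so that
  \<open>1 + |g u| \<le> |m + |g u|| + |g (x k)| \<le> 1 + |g (x k)|\<close>.
\<close>

lemma coordinate_functional_maximal:
  assumes xf: "(x, f) \<in> Pi_pairs Z" and u: "u \<in> carrier (X k)"
    and le: "vnorm (X k) u \<le> vnorm (X k) (x k)"
  shows "norm (f (embed k u)) \<le> norm (f (embed k (x k)))"
proof (cases "f (embed k u) = 0")
  case False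
  have f: "f \<in> bounded_operators Z scalars" "op_norm Z scalars f = 1" and fx: "f x = 1"
    and x: "x \<in> carrier Z" "vnorm Z x = 1"
    using xf by (auto simp: Pi_pairs_def dual_sphere_def unit_sphere_def)
  have f_le: "norm (f y) \<le> 1" if "y \<in> unit_ball Z" for y
    using bounded_operators_le_op_norm[OF f(1) that] f(2) Z_vnorm_nonneg by simp
  have f_add: "f (y \<oplus>\<^bsub>Z\<^esub> z) = f y + f z" if "y \<in> carrier Z" "z \<in> carrier Z" for y z
    using f(1) that by (simp add: bounded_operators_def)
  have f_smult: "f (c \<odot>\<^bsub>Z\<^esub> y) = c * f y" if "y \<in> carrier Z" for c y
    using f(1) that by (simp add: bounded_operators_def)
  define m where "m = f (x(k := \<zero>\<^bsub>X k\<^esub>))"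
  have split: "f (x(k := w)) = m + f (embed k w)" if "w \<in> carrier (X k)" for w
    using update_decomposition[OF x(1) that] f_add update_in_sum(1)[OF x(1)] that
    by (simp add: m_def)
  define p where "p = norm (f (embed k u))"
  define c where "c = of_real p / f (embed k u)"
  have c: "norm c = 1" "c * f (embed k u) = of_real p"
    using False by (simp_all add: c_def p_def norm_divide)
  have "norm (m + of_real p) \<le> 1"
  proof -
    have "x(k := c \<odot>\<^bsub>X k\<^esub> u) \<in> unit_ball Z"
      using update_in_sum[OF x(1), of "c \<odot>\<^bsub>X k\<^esub> u" k] u le x(2) c(1) by (simp add: unit_ball_def)
    from f_le[OF this] show ?thesis
      using u by (simp add: split embed_smult f_smult c(2))
  qed
  moreover have "m + f (embed k (x k)) = 1"
    using split[of "x k"] x(1) fx by simp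
  then have "(m + of_real p) + f (embed k (x k)) = of_real (1 + p)"
    by (simp add: algebra_simps)
  then have "1 + p \<le> norm (m + of_real p) + norm (f (embed k (x k)))"
    using norm_triangle_ineq[of "m + of_real p" "f (embed k (x k))"]
    by (simp add: p_def del: of_real_add)
  ultimately show ?thesis
    by (simp add: p_def)
qed simp

text \<open>
  Put \<open>t = \<parallel>x k\<parallel>\<close> and \<open>r = g (x k)\<close>. Maximality says that \<open>|g| \<le> |r|\<close> on the ball of radius \<open>t\<close>, so for
  \<open>r \<noteq> 0\<close> the functional \<open>h = (t / r) g\<close> has norm one and takes the value \<open>1\<close> at the unit vector
  \<open>y = x k / t\<close>. Dividing by the scalar \<open>r\<close>, and not by \<open>|r|\<close>, makes \<open>h y = 1\<close> exact whatever the
  phase of \<open>r\<close>. Since \<open>g (S (x k)) = r h (S y)\<close> and \<open>|r| \<le> 1\<close>, the pair \<open>(y, h)\<close> gives the bound.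
\<close>

lemma norm_functional_coordinate_operator_le:
  assumes xf: "(x, f) \<in> Pi_pairs Z" and S: "S \<in> bounded_operators (X k) (X k)"
  shows "ennreal (norm (f (embed k (S (x k))))) \<le> numerical_radius (X k) S"
proof -
  have f: "f \<in> bounded_operators Z scalars" "op_norm Z scalars f = 1"
    and x: "x \<in> carrier Z" "vnorm Z x = 1"
    using xf by (auto simp: Pi_pairs_def dual_sphere_def unit_sphere_def)
  define g where "g u = f (embed k u)" for u
  define r where "r = g (x k)"
  define t where "t = vnorm (X k) (x k)"
  have xk: "x k \<in> carrier (X k)"
    using x(1) by simp
  have t: "0 \<le> t" "t \<le> 1"
    using vnorm_component_le[OF x(1), of k] x(2) xk by (auto simp: t_def)
  have S_mem: "S u \<in> carrier (X k)" if "u \<in> carrier (X k)" for u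
    using S that by (auto simp: bounded_operators_def)
  have S_smult: "S (c \<odot>\<^bsub>X k\<^esub> u) = c \<odot>\<^bsub>X k\<^esub> S u" if "u \<in> carrier (X k)" for c u
    using S that by (simp add: bounded_operators_def)
  have g_add: "g (u \<oplus>\<^bsub>X k\<^esub> v) = g u + g v" if "u \<in> carrier (X k)" "v \<in> carrier (X k)" for u v
    using f(1) that by (simp add: g_def embed_add bounded_operators_def)
  have g_smult: "g (c \<odot>\<^bsub>X k\<^esub> u) = c * g u" if "u \<in> carrier (X k)" for c u
    using f(1) that by (simp add: g_def embed_smult bounded_operators_def)
  have g_max: "norm (g u) \<le> norm r" if "u \<in> carrier (X k)" "vnorm (X k) u \<le> t" for u
    using coordinate_functional_maximal[OF xf, of u k] that by (simp add: g_def r_def t_def)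
  have r_le: "norm r \<le> 1"
    using bounded_operators_le_op_norm[OF f(1), of "embed k (x k)"] f(2) Z_vnorm_nonneg t xk
    by (simp add: r_def g_def unit_ball_def t_def)
  show ?thesis
  proof (cases "r = 0")
    case True
    \<comment> \<open>A positive multiple of \<open>S (x k)\<close> lies in the ball of radius \<open>t\<close>, where \<open>g\<close> vanishes.\<close>
    obtain C where C: "\<And>u. u \<in> carrier (X k) \<Longrightarrow> vnorm (X k) (S u) \<le> C * vnorm (X k) u"
      using bounded_operators_bound[OF S] by blast
    let ?d = "inverse (1 + \<bar>C\<bar>)"
    have d: "0 < ?d"
      by simp
    have "vnorm (X k) (S (x k)) \<le> \<bar>C\<bar> * t"
      using C[OF xk] mult_right_mono[OF abs_ge_self t(1), of C] by (simp add: t_def)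
    also have "\<dots> \<le> (1 + \<bar>C\<bar>) * t"
      using t(1) by (simp add: algebra_simps)
    finally have "?d * vnorm (X k) (S (x k)) \<le> t"
      using d by (simp add: field_simps)
    then have "norm (g (of_real ?d \<odot>\<^bsub>X k\<^esub> S (x k))) \<le> norm r"
      using d by (intro g_max) (simp_all add: S_mem xk del: of_real_inverse)
    then have "g (S (x k)) = 0"
      using True d S_mem[OF xk] by (simp add: g_smult norm_mult mult_le_0_iff del: of_real_inverse)
    then show ?thesis
      by (simp add: g_def)
  next
    case False
    have "t \<noteq> 0"
    proof
      assume "t = 0"
      then have "x k = \<zero>\<^bsub>X k\<^esub>"
        using xk by (simp add: t_def)
      then have "r = 0"
        using g_smult[OF xk, of 0] by (simp add: r_def)
      then show False
        using False by simp
    qed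
    then have t_pos: "0 < t"
      using t by simp
    define y where "y = of_real (inverse t) \<odot>\<^bsub>X k\<^esub> x k"
    define h where "h u = of_real t * g u / r" for u
    have y: "y \<in> carrier (X k)" "vnorm (X k) y = 1"
      using xk t_pos by (simp_all add: y_def flip: t_def del: of_real_inverse)
    have hy: "h y = 1"
      using False t_pos by (simp add: h_def y_def g_smult[OF xk] r_def[symmetric])
    have h_le: "norm (h u) \<le> 1" if "u \<in> carrier (X k)" "vnorm (X k) u \<le> 1" for u
    proof -
      have "norm (g (of_real t \<odot>\<^bsub>X k\<^esub> u)) \<le> norm r"
        using that t mult_left_mono[OF that(2) t(1)] by (intro g_max) simp_all
      then show ?thesis
        using False that(1) t by (simp add: h_def g_smult norm_mult norm_divide)
    qed
    have "h \<in> bounded_operators (X k) scalars"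
    proof -
      obtain C where C: "\<And>z. z \<in> carrier Z \<Longrightarrow> norm (f z) \<le> C * vnorm Z z"
        using bounded_operators_bound[OF f(1)] by auto
      have "norm (h u) \<le> (t / norm r * C) * vnorm (X k) u" if u: "u \<in> carrier (X k)" for u
      proof -
        have "norm (h u) = t / norm r * norm (g u)"
          using t by (simp add: h_def norm_mult norm_divide)
        also have "\<dots> \<le> t / norm r * (C * vnorm (X k) u)"
          using C[of "embed k u"] u t by (intro mult_left_mono) (simp_all add: g_def)
        finally show ?thesis
          by simp
      qed
      then have "\<exists>C. \<forall>u\<in>carrier (X k). norm (h u) \<le> C * vnorm (X k) u"
        by blast
      then show ?thesis
        by (simp add: bounded_operators_def) (simp add: h_def g_add g_smult distrib_left add_divide_distrib mult.left_commute)
    qed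
    moreover have "op_norm (X k) scalars h = 1"
      unfolding op_norm_def
    proof (rule cSup_eq_maximum)
      show "1 \<in> (\<lambda>u. vnorm scalars (h u)) ` unit_ball (X k)"
        using y hy by (intro image_eqI[of _ _ y]) (simp_all add: unit_ball_def)
    qed (use h_le in \<open>auto simp: unit_ball_def\<close>)
    ultimately have yh: "(y, h) \<in> Pi_pairs (X k)"
      using y hy by (simp add: Pi_pairs_def unit_sphere_def dual_sphere_def)
    have "h (S y) = g (S (x k)) / r"
      using t_pos S_mem[OF xk] by (simp add: h_def y_def S_smult[OF xk] g_smult)
    then have "norm (g (S (x k))) = norm r * norm (h (S y))"
      using False by (simp add: norm_divide)
    also have "\<dots> \<le> norm (h (S y))"
      using mult_right_mono[OF r_le, of "norm (h (S y))"] by simp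
    finally have "ennreal (norm (g (S (x k)))) \<le> ennreal (norm (h (S y)))"
      by (rule ennreal_leI)
    also have "\<dots> \<le> numerical_radius (X k) S"
      unfolding numerical_radius_def using yh by (intro SUP_upper2[of "(y, h)"]) auto
    finally show ?thesis
      by (simp add: g_def)
  qed
qed

text \<open>
  The \<open>k\<close>-th coordinate maps the unit ball of the sum onto that of \<open>X k\<close>, and \<open>embed k\<close> is isometric, so
  extending \<open>S\<close> by zero preserves its norm.
\<close>

lemma numerical_index_le_summand: "numerical_index Z \<le> numerical_index (X k)"
  unfolding numerical_index_def[of "X k"]
proof (rule INF_greatest)
  fix S assume "S \<in> {S \<in> bounded_operators (X k) (X k). op_norm (X k) (X k) S = 1}"
  then have S: "S \<in> bounded_operators (X k) (X k)" and S_norm: "op_norm (X k) (X k) S = 1"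
    by auto
  have S_mem: "S u \<in> carrier (X k)" if "u \<in> carrier (X k)" for u
    using S that by (auto simp: bounded_operators_def)
  define T where "T x = embed k (S (x k))" for x
  have "T \<in> bounded_operators Z Z"
  proof -
    obtain C where C: "\<And>u. u \<in> carrier (X k) \<Longrightarrow> vnorm (X k) (S u) \<le> C * vnorm (X k) u"
      using bounded_operators_bound[OF S] by blast
    have "vnorm Z (T x) \<le> \<bar>C\<bar> * vnorm Z x" if x: "x \<in> carrier Z" for x
    proof -
      have xk: "x k \<in> carrier (X k)"
        using x by simp
      have "vnorm Z (T x) \<le> C * vnorm (X k) (x k)"
        using C[OF xk] S_mem[OF xk] by (simp add: T_def)
      also have "\<dots> \<le> \<bar>C\<bar> * vnorm (X k) (x k)"
        using xk by (intro mult_right_mono) auto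
      also have "\<dots> \<le> \<bar>C\<bar> * vnorm Z x"
        using vnorm_component_le[OF x] by (intro mult_left_mono) auto
      finally show ?thesis .
    qed
    moreover have "T (x \<oplus>\<^bsub>Z\<^esub> y) = T x \<oplus>\<^bsub>Z\<^esub> T y" if "x \<in> carrier Z" "y \<in> carrier Z" for x y
    proof -
      have "S (x k \<oplus>\<^bsub>X k\<^esub> y k) = S (x k) \<oplus>\<^bsub>X k\<^esub> S (y k)"
        using S that by (simp add: bounded_operators_def)
      then show ?thesis
        using that by (simp add: T_def embed_add[symmetric] S_mem) (simp add: Z_add)
    qed
    moreover have "T (c \<odot>\<^bsub>Z\<^esub> x) = c \<odot>\<^bsub>Z\<^esub> T x" if "x \<in> carrier Z" for c x
    proof -
      have "S (c \<odot>\<^bsub>X k\<^esub> x k) = c \<odot>\<^bsub>X k\<^esub> S (x k)"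
        using S that by (simp add: bounded_operators_def)
      then show ?thesis
        using that by (simp add: T_def embed_smult[symmetric] S_mem) (simp add: Z_smult)
    qed
    moreover have "T \<in> carrier Z \<rightarrow> carrier Z"
      by (simp add: T_def S_mem)
    ultimately show ?thesis
      by (auto simp: bounded_operators_def)
  qed
  moreover have "op_norm Z Z T = 1"
  proof -
    have "(\<lambda>x. x k) ` unit_ball Z = unit_ball (X k)"
    proof (intro equalityI subsetI)
      fix u assume "u \<in> (\<lambda>x. x k) ` unit_ball Z"
      then obtain x where "x \<in> unit_ball Z" "u = x k"
        by auto
      then show "u \<in> unit_ball (X k)"
        using vnorm_component_le[of x k] by (auto simp: unit_ball_def)
    next
      fix u assume "u \<in> unit_ball (X k)"
      then show "u \<in> (\<lambda>x. x k) ` unit_ball Z"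
        by (intro image_eqI[of _ _ "embed k u"]) (simp_all add: unit_ball_def, simp add: embed_def)
    qed
    then have "(\<lambda>x. vnorm (X k) (S (x k))) ` unit_ball Z = (\<lambda>u. vnorm (X k) (S u)) ` unit_ball (X k)"
      using image_image[of "\<lambda>u. vnorm (X k) (S u)" "\<lambda>x. x k" "unit_ball Z"] by simp
    moreover have "(\<lambda>x. vnorm Z (T x)) ` unit_ball Z = (\<lambda>x. vnorm (X k) (S (x k))) ` unit_ball Z"
      by (intro image_cong) (auto simp: T_def unit_ball_def S_mem)
    ultimately show ?thesis
      using S_norm by (simp add: op_norm_def)
  qed
  ultimately have "numerical_index Z \<le> numerical_radius Z T"
    unfolding numerical_index_def by (intro INF_lower) simp
  also have "\<dots> \<le> numerical_radius (X k) S"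
    unfolding numerical_radius_def[of Z] T_def
    by (rule SUP_least) (use norm_functional_coordinate_operator_le[OF _ S] in auto)
  finally show "numerical_index Z \<le> numerical_radius (X k) S" .
qed

end

theorem theorem2p1:
  fixes E :: "('i \<Rightarrow> real) set"
    and N :: "('i \<Rightarrow> real) \<Rightarrow> real"
    and A :: "('i \<Rightarrow> real) set"
    and X :: "'i \<Rightarrow> ('k::real_normed_field, 'v) normed_space"
  assumes "absolute_norm E N"
    and "A \<subseteq> unit_sphere (seq_space E N)"
    and "unit_sphere (seq_space E N)
           \<subseteq> Metric_space.mtopology E (vdist (seq_space E N)) closure_of A"
    and "\<And>a. a \<in> A \<Longrightarrow> \<exists>b\<in>kothe_dual_sphere E N. ((\<lambda>i. b i * a i) has_sum 1) UNIV"
    and "\<And>i. banach_space (X i)"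
    and "\<And>i. carrier (X i) \<noteq> {\<zero>\<^bsub>X i\<^esub>}"
  shows "numerical_index (E_sum E N X) \<le> (INF i. numerical_index (X i))"
proof -
  interpret absolute_sum E N X
    using assms(1,5) by unfold_locales (simp_all add: banach_space_def)
  show ?thesis
    by (intro INF_greatest numerical_index_le_summand)
qed

end
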